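(* Let $\{p_n\}_{n\ge1}$, $\{q_n\}_{n\ge1}$ be complex sequences with $\sum_{n\ge1}(|p_n|+|q_n|)<\infty$, let $\alpha\ne\beta$ be complex numbers with $|\alpha|=|\beta|\ne0$, suppose $q_n\ne\alpha\beta$ for all $n\ge1$, and suppose $\lambda=\alpha/\beta$ is not a root of unity. Let $P_n,Q_n$ be the convergents of the continued fraction with partial numerators $-\alpha\beta+q_n$ and partial denominators $\alpha+\beta+p_n$ ($n\ge1$), put $$a=\lim_{n\to\infty}\alpha^{-n}(P_n-\beta P_{n-1}),\quad b=-\lim_{n\to\infty}\beta^{-n}(P_n-\alpha P_{n-1}),$$ $$c=\lim_{n\to\infty}\alpha^{-n}(Q_n-\beta Q_{n-1}),\quad d=-\lim_{n\to\infty}\beta^{-n}(Q_n-\alpha Q_{n-1}),$$ and $h(z)=(az+b)/(cz+d)$. The sequential closure of the approximants is $\mathbb{T}'=h(\mathbb{T})$, where $\mathbb{T}$ is the unit circle. If $cd\ne0$, the points of $\mathbb{T}'=\frac{a\mathbb{T}+b}{c\mathbb{T}+d}$ with the highest and lowest concentrations of approximants are $$\frac{\frac ac|c|+\frac bd|d|}{|c|+|d|}\qquad\text{and}\qquad\frac{-\frac ac|c|+\frac bd|d|}{-|c|+|d|},$$ respectively. If either $c=0$ or $d=0$, then all points of the sequential closure have the same concentration. The radius of the sequential closure circle in $\mathbb{C}$ is $$\left|\frac{\alpha-\beta}{|c|^2-|d|^2}\prod_{n=1}^\infty\left(1-\frac{q_n}{\alpha\beta}\right)\right|,$$ and its center is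 the complex point $$\frac{|h(1)|^2(h(-1)-h(i))+|h(-1)|^2(h(i)-h(1))+|h(i)|^2(h(1)-h(-1))}{h(1)(\overline{h(i)}-\overline{h(-1)})+h(-1)(\overline{h(1)}-\overline{h(i)})+h(i)(\overline{h(-1)}-\overline{h(1)})}.$$ The sequential closure is a line in $\mathbb{C}$ if and only if $|c|=|d|$, and in this case the point of least concentration is $\infty$.
   Context: $\widehat{\mathbb{C}}=\mathbb{C}\cup\{\infty\}$ is the Riemann sphere. The sequential closure of a sequence in $\widehat{\mathbb{C}}$ is the set of limits of its convergent subsequences; "a line in $\mathbb{C}$" means a Euclidean line together with $\infty$. The convergents of the continued fraction $\frac{a_1}{b_1}{\atop+}\frac{a_2}{b_2}{\atop+}\cdots=a_1/(b_1+a_2/(b_2+\cdots))$ are given by $P_{-1}=1$, $P_0=0$, $Q_{-1}=0$, $Q_0=1$, $P_n=b_nP_{n-1}+a_nP_{n-2}$, $Q_n=b_nQ_{n-1}+a_nQ_{n-2}$; the approximants are $f_n=P_n/Q_n$. Under the stated hypotheses the limits $a,b,c,d$ exist, $ad-bc\neq 0$, and $f_n$ is asymptotic (in the chordal metric) to $h(\lambda^{n+1})$. Concentration: the limiting probability measure of the approximants on $\mathbb{T}'$ is $P(S)=\mu(h^{-1}(S))/2\pi$, where $\mu$ is Lebesgue (arc length) measure on $\mathbb{T}$. The concentration of approximants at a point of $\mathbb{T}'$ is the density of $P$ with respect to arc length on $\mathbb{T}'$, i.e. at $h(e^{i\theta})$ it is $1/(2\pi|g'(\theta)|)$ with $g(\theta)=h(e^{i\theta})$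 (and at $\infty$, when $\infty\in\mathbb{T}'$, its limiting value $0$). The circle radius and center formulas refer to the case where $\mathbb{T}'$ is a circle in $\mathbb{C}$; when $|c|=|d|$ the second displayed point is read as $\infty$. *)

theory Defs
  imports "HOL-Analysis.Analysis"
begin

text \<open>The Riemann sphere is the one-point compactification of the complex plane; the point at
  infinity is \<^const>\<open>None\<close>.\<close>

type_synonym riemann_sphere = "complex option"

abbreviation riemann_topology :: "riemann_sphere topology" where
  "riemann_topology \<equiv> Alexandroff_compactification euclidean"

text \<open>The quotient \<open>x / y\<close> as a point of the sphere; it is only used when \<open>x\<close> and \<open>y\<close> are not both
  zero.\<close>

definition sphere_div :: "complex \<Rightarrow> complex \<Rightarrow> riemann_sphere" where
  "sphere_div x y = (if y = 0 then None else Some (x / y))"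

definition sphere_moebius :: "complex \<Rightarrow> complex \<Rightarrow> complex \<Rightarrow> complex \<Rightarrow> complex \<Rightarrow> riemann_sphere" where
  "sphere_moebius a b c d z = sphere_div (a * z + b) (c * z + d)"

definition seq_closure :: "'a topology \<Rightarrow> (nat \<Rightarrow> 'a) \<Rightarrow> 'a set" where
  "seq_closure X f = {x. \<exists>r. strict_mono r \<and> limitin X (f \<circ> r) x sequentially}"

definition is_line :: "riemann_sphere set \<Rightarrow> bool" where
  "is_line L \<longleftrightarrow> (\<exists>u v. u \<noteq> v \<and> L = insert None (Some ` (affine hull {u, v})))"

text \<open>The three-term recurrence \<open>X\<^sub>n = B\<^sub>n X\<^sub>n\<^sub>-\<^sub>1 + A\<^sub>n X\<^sub>n\<^sub>-\<^sub>2\<close> for \<open>n \<ge> 1\<close>, with partial numerators \<open>A\<close> and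
  partial denominators \<open>B\<close> (the values at index 0 are ignored), started from \<open>X\<^sub>-\<^sub>1 = x\<close> and
  \<open>X\<^sub>0 = y\<close>.\<close>

fun cf_rec :: "(nat \<Rightarrow> complex) \<Rightarrow> (nat \<Rightarrow> complex) \<Rightarrow> complex \<Rightarrow> complex \<Rightarrow> nat \<Rightarrow> complex" where
  "cf_rec A B x y 0 = y"
| "cf_rec A B x y (Suc 0) = B 1 * y + A 1 * x"
| "cf_rec A B x y (Suc (Suc n)) =
     B (Suc (Suc n)) * cf_rec A B x y (Suc n) + A (Suc (Suc n)) * cf_rec A B x y n"

definition cf_num :: "(nat \<Rightarrow> complex) \<Rightarrow> (nat \<Rightarrow> complex) \<Rightarrow> nat \<Rightarrow> complex" where
  "cf_num A B = cf_rec A B 1 0"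

definition cf_den :: "(nat \<Rightarrow> complex) \<Rightarrow> (nat \<Rightarrow> complex) \<Rightarrow> nat \<Rightarrow> complex" where
  "cf_den A B = cf_rec A B 0 1"

text \<open>In the following, \<open>h\<close> parametrises a curve in the sphere by the unit circle, and
  \<open>g t = h (e^{it})\<close>. The value of \<^term>\<open>the None\<close> is irrelevant: when \<open>h\<close> is a Moebius
  transformation, derivatives of \<open>g\<close> are only taken where \<open>h\<close> is finite in a neighbourhood.\<close>

definition circle_curve :: "(complex \<Rightarrow> riemann_sphere) \<Rightarrow> real \<Rightarrow> complex" where
  "circle_curve h t = the (h (cis t))"

text \<open>The limiting distribution \<open>\<mu> (h\<^sup>-\<^sup>1 S) / 2 \<pi>\<close>, where arc length \<open>\<mu>\<close> on the unit circle is
  Lebesgue measure of the angle in \<open>[0, 2 \<pi>)\<close>.\<close>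

definition limit_prob :: "(complex \<Rightarrow> riemann_sphere) \<Rightarrow> riemann_sphere set \<Rightarrow> ennreal" where
  "limit_prob h S = emeasure lborel {t \<in> {0..<2*pi}. h (cis t) \<in> S} / ennreal (2 * pi)"

text \<open>Arc length on the part of the curve in the plane: the image under \<open>g\<close> of \<open>|g'(t)| dt\<close>.\<close>

definition arc_length :: "(complex \<Rightarrow> riemann_sphere) \<Rightarrow> complex measure" where
  "arc_length h =
     distr (density (restrict_space lborel {t \<in> {0..<2*pi}. h (cis t) \<noteq> None})
             (\<lambda>t. ennreal (cmod (vector_derivative (circle_curve h) (at t)))))
       borel (circle_curve h)"

text \<open>The density of \<^const>\<open>limit_prob\<close> with respect to \<^const>\<open>arc_length\<close>, as a pointwise
  defined function: \<open>1 / (2 \<pi> |g'(t)|)\<close> at \<open>g t\<close>, and the limiting value \<open>0\<close> at infinity. Lemmas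
  \<open>limit_prob_eq_concentration\<close> and \<open>concentration_tendsto_0\<close> below confirm this reading.\<close>

definition concentration :: "(complex \<Rightarrow> riemann_sphere) \<Rightarrow> riemann_sphere \<Rightarrow> real" where
  "concentration h w =
     (case w of
        None \<Rightarrow> 0
      | Some _ \<Rightarrow>
          1 / (2 * pi * cmod (vector_derivative (circle_curve h)
            (at (THE t. 0 \<le> t \<and> t < 2 * pi \<and> h (cis t) = w)))))"

lemma sphere_moebius_inj:
  assumes "a * d - b * c \<noteq> 0"
  shows "inj (sphere_moebius a b c d)"
proof (rule injI)
  fix x y assume e: "sphere_moebius a b c d x = sphere_moebius a b c d y"
  show "x = y"
  proof (cases "c * x + d = 0")
    case True
    then have "c * y + d = 0"
      using e by (auto simp: sphere_moebius_def sphere_div_def split: if_splits)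
    with True have "c * x = c * y" by (metis add_right_cancel)
    moreover have "c \<noteq> 0" using True assms by auto
    ultimately show ?thesis by simp
  next
    case False
    then have y: "c * y + d \<noteq> 0" and "(a * x + b) / (c * x + d) = (a * y + b) / (c * y + d)"
      using e by (auto simp: sphere_moebius_def sphere_div_def split: if_splits)
    then have "(a * x + b) * (c * y + d) = (a * y + b) * (c * x + d)"
      using False by (simp add: frac_eq_eq)
    then have "(a * d - b * c) * (x - y) = 0" by (simp add: algebra_simps)
    with assms show ?thesis by simp
  qed
qed

lemma circle_curve_deriv:
  assumes "c * cis t + d \<noteq> 0"
  shows "vector_derivative (circle_curve (sphere_moebius a b c d)) (at t) =
           (a * d - b * c) * (\<i> * cis t) / (c * cis t + d)\<^sup>2"
proof -
  have cis: "(cis has_vector_derivative (\<i> * cis t)) (at t)"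
    unfolding has_vector_derivative_def
    by (rule has_derivative_eq_rhs, rule has_derivative_cis[OF has_derivative_ident])
       (auto simp: scaleR_conv_of_real)
  have fd: "((\<lambda>z. (a * z + b) / (c * z + d)) has_field_derivative
       (a * d - b * c) / (c * cis t + d)\<^sup>2) (at (cis t))"
    using assms by (auto intro!: derivative_eq_intros simp: field_simps power2_eq_square)
  have D: "((\<lambda>z. (a * z + b) / (c * z + d)) \<circ> cis has_vector_derivative
       (\<i> * cis t) * ((a * d - b * c) / (c * cis t + d)\<^sup>2)) (at t)"
    by (rule field_vector_diff_chain_at[OF cis fd])
  have "open {s. c * cis s + d \<noteq> 0}"
    by (rule open_Collect_neq) (auto intro!: continuous_intros)
  then have "(circle_curve (sphere_moebius a b c d) has_vector_derivative
       (\<i> * cis t) * ((a * d - b * c) / (c * cis t + d)\<^sup>2)) (at t)"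
    by (rule has_vector_derivative_transform_within_open[OF D])
       (use assms in \<open>auto simp: circle_curve_def sphere_moebius_def sphere_div_def\<close>)
  then show ?thesis
    by (simp add: vector_derivative_at mult_ac)
qed

lemma concentration_circle_curve:
  assumes "a * d - b * c \<noteq> 0" "0 \<le> t" "t < 2 * pi" "sphere_moebius a b c d (cis t) = Some w"
  shows "concentration (sphere_moebius a b c d) (Some w) =
           1 / (2 * pi * cmod (vector_derivative (circle_curve (sphere_moebius a b c d)) (at t)))"
proof -
  have "(THE s. 0 \<le> s \<and> s < 2 * pi \<and> sphere_moebius a b c d (cis s) = Some w) = t"
  proof (rule the_equality)
    fix s assume s: "0 \<le> s \<and> s < 2 * pi \<and> sphere_moebius a b c d (cis s) = Some w"
    then have "cis s = cis t"
      using assms(4) sphere_moebius_inj[OF assms(1)] by (metis injD)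
    then obtain n :: int where n: "s = t + 2 * pi * n"
      using sin_cos_eq_iff[of s t] by (auto simp: complex_eq_iff)
    then have "\<bar>2 * pi * n\<bar> < 2 * pi"
      using s assms(2,3) by linarith
    then have "n = 0" by (simp add: abs_mult)
    with n show "s = t" by simp
  qed (use assms in auto)
  then show ?thesis by (simp add: concentration_def)
qed

lemma concentration_arith:
  fixes u v :: real
  assumes "u \<noteq> 0" "v \<noteq> 0"
  shows "1 / (2 * pi * (u / v\<^sup>2)) = u / (2 * pi * (u / v)\<^sup>2)"
  using assms by (simp add: field_simps power2_eq_square)

lemma concentration_Some:
  assumes D: "a * d - b * c \<noteq> 0" and w: "Some w \<in> sphere_moebius a b c d ` sphere 0 1"
  shows "concentration (sphere_moebius a b c d) (Some w) =
           cmod (a * d - b * c) / (2 * pi * (cmod (a - c * w))\<^sup>2)"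
proof -
  obtain z where z: "cmod z = 1" "sphere_moebius a b c d z = Some w"
    using w by (auto simp: image_iff)
  then obtain t where t: "z = cis t" "0 \<le> t" "t < 2 * pi"
    using complex_unimodular_polar by (metis cis.code)
  with z have nz: "c * cis t + d \<noteq> 0" and w_eq: "w = (a * cis t + b) / (c * cis t + d)"
    by (auto simp: sphere_moebius_def sphere_div_def split: if_splits)
  have *: "a - c * w = (a * d - b * c) / (c * cis t + d)"
    using nz unfolding w_eq by (simp add: field_simps)
  have "concentration (sphere_moebius a b c d) (Some w) =
      1 / (2 * pi * cmod ((a * d - b * c) * (\<i> * cis t) / (c * cis t + d)\<^sup>2))"
    using concentration_circle_curve[OF D t(2,3)] z t circle_curve_deriv[OF nz] by simp
  also have "\<dots> = cmod (a * d - b * c) / (2 * pi * (cmod (a - c * w))\<^sup>2)"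
    using D nz concentration_arith[of "cmod (a * d - b * c)" "cmod (c * cis t + d)"]
    unfolding * by (simp add: norm_mult norm_divide norm_power)
  finally show ?thesis .
qed

lemma concentration_tendsto_0:
  assumes D: "a * d - b * c \<noteq> 0" and inf: "None \<in> sphere_moebius a b c d ` sphere 0 1"
  shows "((\<lambda>w. concentration (sphere_moebius a b c d) (Some w)) \<longlongrightarrow> 0)
           (inf at_infinity (principal {w. Some w \<in> sphere_moebius a b c d ` sphere 0 1}))"
proof -
  have c: "c \<noteq> 0"
    using D inf by (auto simp: sphere_moebius_def sphere_div_def split: if_splits)
  have "filterlim (\<lambda>w. a + (- c) * w) at_infinity at_infinity"
    using c by (intro tendsto_add_filterlim_at_infinity[of _ a] tendsto_const
        tendsto_mult_filterlim_at_infinity[of _ "-c"] filterlim_ident) auto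
  then have "filterlim (\<lambda>w. cmod (a - c * w)) at_top at_infinity"
    by (auto dest: filterlim_at_infinity_imp_norm_at_top)
  then have "filterlim (\<lambda>w. 2 * pi * (cmod (a - c * w))\<^sup>2) at_top at_infinity"
    by (intro filterlim_tendsto_pos_mult_at_top[OF tendsto_const] filterlim_pow_at_top) auto
  then have "((\<lambda>w. cmod (a * d - b * c) / (2 * pi * (cmod (a - c * w))\<^sup>2)) \<longlongrightarrow> 0) at_infinity"
    by (intro real_tendsto_divide_at_top[OF tendsto_const])
  then have lim: "((\<lambda>w. cmod (a * d - b * c) / (2 * pi * (cmod (a - c * w))\<^sup>2)) \<longlongrightarrow> 0)
      (inf at_infinity (principal {w. Some w \<in> sphere_moebius a b c d ` sphere 0 1}))"
    by (rule tendsto_mono[rotated]) simp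
  show ?thesis
    by (rule Lim_transform_eventually[OF lim])
       (auto simp: eventually_inf_principal concentration_Some[OF D])
qed

lemma limit_prob_eq_concentration:
  assumes D: "a * d - b * c \<noteq> 0" and S: "S \<in> sets borel"
  defines "h \<equiv> sphere_moebius a b c d"
  shows "limit_prob h (Some ` S) =
           (\<integral>\<^sup>+ w\<in>S. ennreal (concentration h (Some w)) \<partial>arc_length h)"
proof -
  define g where "g = circle_curve h"
  define A where "A = {t \<in> {0..<2*pi}. h (cis t) \<noteq> None}"
  define R where "R = restrict_space lborel A"
  have A_eq: "A = {0..<2*pi} \<inter> {t. c * cis t + d \<noteq> 0}"
    by (auto simp: A_def h_def sphere_moebius_def sphere_div_def)
  have "open {t. c * cis t + d \<noteq> 0}"
    by (rule open_Collect_neq) (auto intro!: continuous_intros)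
  then have A: "A \<in> sets lborel"
    unfolding A_eq by auto
  have cis_nz: "c * cis t + d \<noteq> 0" if "t \<in> A" for t
    using that A_eq by auto
  have [measurable]: "cis \<in> borel_measurable borel"
    by (intro borel_measurable_continuous_onI continuous_intros)
  have g_eq: "g t = (a * cis t + b) / (c * cis t + d)" if "t \<in> A" for t
    using cis_nz[OF that] by (simp add: g_def circle_curve_def h_def sphere_moebius_def sphere_div_def)
  have hg: "h (cis t) = Some (g t)" if "t \<in> A" for t
    using that by (auto simp: A_def g_def circle_curve_def)
  have g'_eq: "vector_derivative g (at t) =
      (a * d - b * c) * (\<i> * cis t) / (c * cis t + d)\<^sup>2" if "t \<in> A" for t
    using circle_curve_deriv[OF cis_nz[OF that]] by (simp add: g_def h_def)
  have "(\<lambda>t. (a * cis t + b) / (c * cis t + d)) \<in> borel_measurable R"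
    unfolding R_def by (rule measurable_restrict_space1) simp
  then have g_meas: "g \<in> borel_measurable R"
    by (rule measurable_cong[THEN iffD1, rotated]) (auto simp: g_eq R_def space_restrict_space)
  have "(\<lambda>t. ennreal (cmod ((a * d - b * c) * (\<i> * cis t) / (c * cis t + d)\<^sup>2))) \<in> borel_measurable R"
    unfolding R_def by (rule measurable_restrict_space1) simp
  then have g'_meas: "(\<lambda>t. ennreal (cmod (vector_derivative g (at t)))) \<in> borel_measurable R"
    by (rule measurable_cong[THEN iffD1, rotated]) (auto simp: g'_eq R_def space_restrict_space)
  define K where "K = {w. Some w \<in> h ` sphere 0 1}"
  have K_eq: "K = {w. cmod (d * w - b) = cmod (a - c * w) \<and> a - c * w \<noteq> 0}"
  proof (intro set_eqI iffI)
    fix w assume "w \<in> K"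
    then obtain z where z: "cmod z = 1" "c * z + d \<noteq> 0" "w = (a * z + b) / (c * z + d)"
      by (auto simp: K_def h_def sphere_moebius_def sphere_div_def split: if_splits)
    have "d * w - b = z * ((a * d - b * c) / (c * z + d))"
         "a - c * w = (a * d - b * c) / (c * z + d)"
      using z(2) unfolding z(3) by (simp_all add: field_simps)
    then show "w \<in> {w. cmod (d * w - b) = cmod (a - c * w) \<and> a - c * w \<noteq> 0}"
      using z D by (auto simp: norm_mult norm_divide)
  next
    fix w assume w: "w \<in> {w. cmod (d * w - b) = cmod (a - c * w) \<and> a - c * w \<noteq> 0}"
    define z where "z = (d * w - b) / (a - c * w)"
    have "cmod z = 1" using w by (auto simp: z_def norm_divide)
    moreover have n: "c * z + d = (a * d - b * c) / (a - c * w)"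
                  "a * z + b = w * ((a * d - b * c) / (a - c * w))"
      using w unfolding z_def by (simp_all add: field_simps)
    then have "h z = Some w"
      using D w by (simp add: h_def sphere_moebius_def sphere_div_def)
    ultimately show "w \<in> K" unfolding K_def by (force simp: image_iff)
  qed
  have K: "K \<in> sets borel"
    unfolding K_eq by measurable
  define k where "k = (\<lambda>w. if w \<in> K then
      ennreal (cmod (a * d - b * c) / (2 * pi * (cmod (a - c * w))\<^sup>2)) * indicator S w else 0)"
  have k_meas: "k \<in> borel_measurable borel"
    unfolding k_def using K S by measurable
  have gK: "g t \<in> K" if "t \<in> A" for t
    unfolding K_def mem_Collect_eq hg[OF that, symmetric] by (rule imageI) simp
  have arc: "arc_length h = distr (density R (\<lambda>t. ennreal (cmod (vector_derivative g (at t))))) borel g"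
    by (simp add: arc_length_def R_def A_def g_def)
  have AE: "AE w in arc_length h. w \<in> K"
    unfolding arc using g_meas g'_meas K gK
    by (subst AE_distr_iff) (auto simp: AE_density R_def space_restrict_space)
  have "(\<integral>\<^sup>+ w\<in>S. ennreal (concentration h (Some w)) \<partial>arc_length h) = (\<integral>\<^sup>+ w. k w \<partial>arc_length h)"
    by (rule nn_integral_cong_AE, use AE in eventually_elim)
       (auto simp: k_def K_def h_def concentration_Some[OF D])
  also have "\<dots> = (\<integral>\<^sup>+ t. ennreal (cmod (vector_derivative g (at t))) * k (g t) \<partial>R)"
    unfolding arc using g_meas g'_meas k_meas
    by (subst nn_integral_distr) (auto simp: nn_integral_density)
  also have "\<dots> = (\<integral>\<^sup>+ t. ennreal (1 / (2 * pi)) * indicator S (g t) \<partial>R)"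
  proof (rule nn_integral_cong)
    fix t assume "t \<in> space R"
    then have t: "t \<in> A" by (simp add: R_def space_restrict_space)
    have "a - c * g t = (a * d - b * c) / (c * cis t + d)"
      using cis_nz[OF t] unfolding g_eq[OF t] by (simp add: field_simps)
    then have "cmod (vector_derivative g (at t)) *
        (cmod (a * d - b * c) / (2 * pi * (cmod (a - c * g t))\<^sup>2)) = 1 / (2 * pi)"
      using cis_nz[OF t] D unfolding g'_eq[OF t]
      by (simp add: norm_mult norm_divide norm_power power_divide)
        (simp add: power2_eq_square)
    then show "ennreal (cmod (vector_derivative g (at t))) * k (g t) =
        ennreal (1 / (2 * pi)) * indicator S (g t)"
      using gK[OF t] by (simp add: k_def mult.assoc[symmetric] flip: ennreal_mult)
  qed
  also have "\<dots> = (\<integral>\<^sup>+ t. ennreal (1 / (2 * pi)) * indicator {t \<in> A. g t \<in> S} t \<partial>lborel)"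
    unfolding R_def using A
    by (subst nn_integral_restrict_space) (auto intro!: nn_integral_cong simp: indicator_def)
  also have "\<dots> = ennreal (1 / (2 * pi)) * emeasure lborel {t \<in> A. g t \<in> S}"
  proof (rule nn_integral_cmult_indicator)
    have "g -` S \<inter> space R \<in> sets R"
      using g_meas S by (rule measurable_sets)
    moreover have "g -` S \<inter> space R = {t \<in> A. g t \<in> S}"
      by (auto simp: R_def space_restrict_space)
    ultimately show "{t \<in> A. g t \<in> S} \<in> sets lborel"
      using A by (simp add: R_def sets_restrict_space_iff)
  qed
  also have "{t \<in> A. g t \<in> S} = {t \<in> {0..<2*pi}. h (cis t) \<in> Some ` S}"
    using hg by (fastforce simp: A_def)
  finally show ?thesis
    by (simp add: limit_prob_def divide_ennreal_def mult.commute inverse_ennreal inverse_eq_divide)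
qed

end

theory Submission
  imports Defs
begin

text \<open>Every solution \<open>R\<close> of the unperturbed recurrence \<open>R\<^sub>n = (\<alpha> + \<beta>) R\<^sub>n\<^sub>-\<^sub>1 - \<alpha> \<beta> R\<^sub>n\<^sub>-\<^sub>2\<close> is a combination
  of \<open>\<alpha>\<^sup>n\<close> and \<open>\<beta>\<^sup>n\<close>, and the two amplitudes are read off by \<open>\<alpha>\<^sup>-\<^sup>n (R\<^sub>n - \<beta> R\<^sub>n\<^sub>-\<^sub>1)\<close> and
  \<open>\<beta>\<^sup>-\<^sup>n (R\<^sub>n - \<alpha> R\<^sub>n\<^sub>-\<^sub>1)\<close>. The perturbation by \<open>p\<close> and \<open>q\<close> makes the amplitudes drift, but as
  \<open>|\<alpha>| = |\<beta>|\<close> the relative size of the drift in one step is of order \<open>|p\<^sub>n| + |q\<^sub>n|\<close>. Summability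
  first bounds the amplitudes and then makes them converge
  (\<open>perturbed_recurrence_convergent\<close>).

  Solving for \<open>P\<^sub>n\<close> and \<open>Q\<^sub>n\<close> gives \<open>P\<^sub>n / Q\<^sub>n = (a\<^sub>n \<lambda>\<^sup>n\<^sup>+\<^sup>1 + b\<^sub>n) / (c\<^sub>n \<lambda>\<^sup>n\<^sup>+\<^sup>1 + d\<^sub>n)\<close> with coefficients
  tending to \<open>a\<close>, \<open>b\<close>, \<open>c\<close>, \<open>d\<close>. The Casorati determinant \<open>P\<^sub>n Q\<^sub>n\<^sub>-\<^sub>1 - P\<^sub>n\<^sub>-\<^sub>1 Q\<^sub>n\<close> is a product of partial
  numerators (\<open>cf_casorati\<close>), whence \<open>a d - b c = (\<beta> - \<alpha>) \<Prod> (1 - q\<^sub>n / \<alpha> \<beta>) \<noteq> 0\<close>. The powers of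
  \<open>\<lambda>\<close> are dense in the unit circle, so the subsequential limits of the approximants fill out exactly
  the image of the circle under \<open>h\<close> (\<open>seq_closure_asymptotic_moebius\<close>).

  The rest is geometry of one Moebius transformation. As \<open>h'(z) = (a d - b c) / (c z + d)\<^sup>2\<close>, the
  concentration at \<open>h(z)\<close> is a multiple of \<open>|c z + d|\<^sup>2\<close>, whose extrema on the unit circle are, for \<open>c d \<noteq> 0\<close>, the two
  points at which \<open>c z\<close> is parallel to \<open>d\<close> (\<open>concentration_extremal_points\<close>). The image of the circle
  is the Apollonius locus \<open>|d w - b| = |a - c w|\<close>: a circle of centre \<open>(a c\<^sup>* - b d\<^sup>*) / (|c|\<^sup>2 - |d|\<^sup>2)\<close> and
  radius \<open>|a d - b c| / ||c|\<^sup>2 - |d|\<^sup>2|\<close> if \<open>|c| \<noteq> |d|\<close> (\<open>moebius_circle_eq_sphere\<close>), and otherwise the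
  perpendicular bisector of \<open>a / c\<close> and \<open>b / d\<close> (\<open>is_line_moebius_circle_iff\<close>). The symmetric
  expression for the centre is the circumcentre of the three points \<open>h(1)\<close>, \<open>h(-1)\<close>, \<open>h(\<i>)\<close>.\<close>

section \<open>Summable perturbations of a recurrence with constant coefficients\<close>

text \<open>A discrete Gronwall inequality.\<close>

lemma bounded_of_Suc_le_mult:
  fixes M e :: "nat \<Rightarrow> real"
  assumes e: "\<And>n. 0 \<le> e n" "summable e" and M0: "0 \<le> M 0"
    and step: "\<And>n. M (Suc n) \<le> (1 + e n) * M n"
  shows "M n \<le> M 0 * exp (suminf e)"
proof -
  have "M n \<le> M 0 * exp (\<Sum>k<n. e k)"
  proof (induction n)
    case (Suc n)
    have "M (Suc n) \<le> (1 + e n) * M n" by (rule step)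
    also have "\<dots> \<le> (1 + e n) * (M 0 * exp (\<Sum>k<n. e k))"
      using Suc e(1)[of n] by (intro mult_left_mono) auto
    also have "\<dots> \<le> exp (e n) * (M 0 * exp (\<Sum>k<n. e k))"
      using M0 by (intro mult_right_mono exp_ge_add_one_self) auto
    also have "\<dots> = M 0 * exp (\<Sum>k<Suc n. e k)"
      by (simp add: exp_add mult_ac)
    finally show ?case .
  qed simp
  also have "\<dots> \<le> M 0 * exp (suminf e)"
    using M0 e by (intro mult_left_mono) (auto intro: sum_le_suminf)
  finally show ?thesis .
qed

lemma convergent_of_summable_increments:
  fixes x :: "nat \<Rightarrow> 'a :: banach"
  assumes "summable g" and "\<And>n. norm (x (Suc n) - x n) \<le> g n"
  shows "convergent x"
proof -
  have "summable (\<lambda>n. x (Suc n) - x n)"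
    by (rule summable_comparison_test'[OF assms(1)]) (use assms(2) in auto)
  then have "convergent (\<lambda>n. \<Sum>k<n. x (Suc k) - x k)"
    by (simp add: summable_iff_convergent)
  then have "convergent (\<lambda>n. (x n - x 0) + x 0)"
    unfolding sum_lessThan_telescope by (intro convergent_add convergent_const)
  then show ?thesis by simp
qed

text \<open>With \<open>x\<close> and \<open>y\<close> for the two amplitudes, the increments of both are
  \<open>p\<^sub>n R\<^sub>n\<^sub>+\<^sub>1 + q\<^sub>n R\<^sub>n\<close> divided by a power of modulus \<open>\<rho>\<^sup>n\<^sup>+\<^sup>2\<close>, while \<open>R\<^sub>n\<close> itself is at most
  \<open>\<rho>\<^sup>n\<^sup>+\<^sup>1 (|x\<^sub>n| + |y\<^sub>n|) / |\<alpha> - \<beta>|\<close>. This is where equal moduli matter: the powers of \<open>\<rho>\<close> cancel and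
  \<open>|x\<^sub>n| + |y\<^sub>n|\<close> grows by a factor \<open>1 + O(|p\<^sub>n| + |q\<^sub>n|)\<close> in each step.\<close>

lemma perturbed_recurrence_convergent:
  fixes R p q :: "nat \<Rightarrow> complex" and \<alpha> \<beta> :: complex
  assumes pq: "summable (\<lambda>n. cmod (p n) + cmod (q n))"
    and ne: "\<alpha> \<noteq> \<beta>" and mod: "cmod \<alpha> = cmod \<beta>" and nz: "\<beta> \<noteq> 0"
    and R: "\<And>n. R (Suc (Suc n)) = (\<alpha> + \<beta> + p n) * R (Suc n) + (- \<alpha> * \<beta> + q n) * R n"
  shows "convergent (\<lambda>n. (R (Suc n) - \<beta> * R n) / \<alpha> ^ Suc n)"
    and "convergent (\<lambda>n. (R (Suc n) - \<alpha> * R n) / \<beta> ^ Suc n)"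
proof -
  define x where "x = (\<lambda>n. (R (Suc n) - \<beta> * R n) / \<alpha> ^ Suc n)"
  define y where "y = (\<lambda>n. (R (Suc n) - \<alpha> * R n) / \<beta> ^ Suc n)"
  define M where "M = (\<lambda>n. cmod (x n) + cmod (y n))"
  define \<rho> where "\<rho> = cmod \<beta>"
  define C where "C = (1 + 1 / \<rho>) / cmod (\<alpha> - \<beta>)"
  define e where "e = (\<lambda>n. C * (cmod (p n) + cmod (q n)))"
  have \<alpha>: "\<alpha> \<noteq> 0" using mod nz by auto
  have \<rho>: "\<rho> > 0" "cmod \<alpha> = \<rho>" "cmod \<beta> = \<rho>" using nz mod by (auto simp: \<rho>_def)
  have C: "0 \<le> C" using \<rho> by (simp add: C_def)
  have X: "\<alpha> ^ Suc n * x n = R (Suc n) - \<beta> * R n" for n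
    using \<alpha> by (simp add: x_def)
  have Y: "\<beta> ^ Suc n * y n = R (Suc n) - \<alpha> * R n" for n
    using nz by (simp add: y_def)
  have R0: "R n = (\<alpha> ^ Suc n * x n - \<beta> ^ Suc n * y n) / (\<alpha> - \<beta>)" for n
    unfolding X Y using ne by (simp add: field_simps)
  have R1: "R (Suc n) = (\<alpha> ^ Suc (Suc n) * x n - \<beta> ^ Suc (Suc n) * y n) / (\<alpha> - \<beta>)" for n
    unfolding power_Suc[of _ "Suc n"] mult.assoc X Y using ne by (simp add: field_simps)
  have R0_le: "cmod (R n) \<le> \<rho> ^ Suc n * M n / cmod (\<alpha> - \<beta>)" for n
    unfolding R0 norm_divide M_def using ne
    by (intro divide_right_mono order_trans[OF norm_triangle_ineq4])
       (auto simp: norm_mult norm_power \<rho> algebra_simps)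
  have R1_le: "cmod (R (Suc n)) \<le> \<rho> ^ Suc (Suc n) * M n / cmod (\<alpha> - \<beta>)" for n
    unfolding R1 norm_divide M_def using ne
    by (intro divide_right_mono order_trans[OF norm_triangle_ineq4])
       (auto simp: norm_mult norm_power \<rho> algebra_simps)
  have M: "0 \<le> M n" for n by (simp add: M_def)
  have D: "cmod (p n * R (Suc n) + q n * R n) / \<rho> ^ Suc (Suc n) \<le> e n * M n" for n
  proof -
    have "cmod (p n * R (Suc n) + q n * R n) \<le> cmod (p n) * cmod (R (Suc n)) + cmod (q n) * cmod (R n)"
      by (metis norm_mult norm_triangle_ineq)
    also have "\<dots> \<le> cmod (p n) * (\<rho> ^ Suc (Suc n) * M n / cmod (\<alpha> - \<beta>)) +
        cmod (q n) * (\<rho> ^ Suc n * M n / cmod (\<alpha> - \<beta>))"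
      by (intro add_mono mult_left_mono R0_le R1_le) auto
    also have "\<dots> = \<rho> ^ Suc (Suc n) * ((cmod (p n) + cmod (q n) * (1 / \<rho>)) / cmod (\<alpha> - \<beta>) * M n)"
      using \<rho>(1) ne by (simp add: field_simps)
    also have "\<dots> \<le> \<rho> ^ Suc (Suc n) * (e n * M n)"
    proof -
      have "(cmod (p n) + cmod (q n) * (1 / \<rho>)) \<le> (1 + 1 / \<rho>) * (cmod (p n) + cmod (q n))"
        using \<rho>(1) by (simp add: algebra_simps)
      then have "(cmod (p n) + cmod (q n) * (1 / \<rho>)) / cmod (\<alpha> - \<beta>) \<le> e n"
        unfolding e_def C_def times_divide_eq_left by (intro divide_right_mono) auto
      then show ?thesis using M \<rho>(1) by (intro mult_left_mono mult_right_mono) auto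
    qed
    finally show ?thesis using \<rho>(1) by (simp add: pos_divide_le_eq mult_ac)
  qed
  have dx: "x (Suc n) - x n = (p n * R (Suc n) + q n * R n) / \<alpha> ^ Suc (Suc n)" for n
  proof -
    have "x (Suc n) - x n = (R (Suc (Suc n)) - \<beta> * R (Suc n) - \<alpha> * (R (Suc n) - \<beta> * R n)) / \<alpha> ^ Suc (Suc n)"
      using \<alpha> by (simp add: x_def field_simps)
    then show ?thesis unfolding R by (simp add: algebra_simps)
  qed
  have dy: "y (Suc n) - y n = (p n * R (Suc n) + q n * R n) / \<beta> ^ Suc (Suc n)" for n
  proof -
    have "y (Suc n) - y n = (R (Suc (Suc n)) - \<alpha> * R (Suc n) - \<beta> * (R (Suc n) - \<alpha> * R n)) / \<beta> ^ Suc (Suc n)"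
      using nz by (simp add: y_def field_simps)
    then show ?thesis unfolding R by (simp add: algebra_simps)
  qed
  have dx_le: "cmod (x (Suc n) - x n) \<le> e n * M n" and dy_le: "cmod (y (Suc n) - y n) \<le> e n * M n" for n
    unfolding dx dy norm_divide norm_power \<rho> by (rule D)+
  have e: "summable e" "\<And>n. 0 \<le> e n"
    unfolding e_def using C pq by (auto intro: summable_mult)
  have "M (Suc n) \<le> (1 + 2 * e n) * M n" for n
    using dx_le[of n] dy_le[of n] norm_triangle_sub[of "x (Suc n)" "x n"]
      norm_triangle_sub[of "y (Suc n)" "y n"] by (simp add: M_def algebra_simps)
  then have "M n \<le> M 0 * exp (\<Sum>n. 2 * e n)" for n
    by (rule bounded_of_Suc_le_mult[rotated 3]) (use e M in \<open>auto intro: summable_mult\<close>)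
  then obtain K where K: "M n \<le> K" for n by blast
  have s: "summable (\<lambda>n. e n * K)" using e by (intro summable_mult2)
  have le: "e n * M n \<le> e n * K" for n using e K by (intro mult_left_mono) auto
  show "convergent (\<lambda>n. (R (Suc n) - \<beta> * R n) / \<alpha> ^ Suc n)"
    unfolding x_def[symmetric]
    by (rule convergent_of_summable_increments[OF s]) (use dx_le le order_trans in blast)
  show "convergent (\<lambda>n. (R (Suc n) - \<alpha> * R n) / \<beta> ^ Suc n)"
    unfolding y_def[symmetric]
    by (rule convergent_of_summable_increments[OF s]) (use dy_le le order_trans in blast)
qed

text \<open>Each step of the recurrence multiplies the determinant by minus the partial numerator; the
  leading sign comes from \<open>P\<^sub>0 Q\<^sub>-\<^sub>1 - P\<^sub>-\<^sub>1 Q\<^sub>0 = -1\<close>.\<close>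

lemma cf_casorati:
  "cf_num A B (Suc n) * cf_den A B n - cf_num A B n * cf_den A B (Suc n) =
     - (\<Prod>k\<le>n. - A (Suc k))"
proof (induction n)
  case (Suc n)
  have "cf_num A B (Suc (Suc n)) * cf_den A B (Suc n) - cf_num A B (Suc n) * cf_den A B (Suc (Suc n)) =
    - A (Suc (Suc n)) * (cf_num A B (Suc n) * cf_den A B n - cf_num A B n * cf_den A B (Suc n))"
    by (simp add: cf_num_def cf_den_def algebra_simps)
  then show ?case unfolding Suc by simp
qed (simp add: cf_num_def cf_den_def)

section \<open>Powers of a unit complex number of infinite order\<close>

text \<open>Kronecker's theorem in one dimension, transported by \<open>t \<mapsto> cis (2 \<pi> t)\<close>: the angle of \<open>l\<close> is an
  irrational multiple of \<open>2 \<pi>\<close> because \<open>l\<close> has infinite order.\<close>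

lemma dense_powers_unit_circle:
  fixes l z :: complex
  assumes l: "cmod l = 1" and nr: "\<And>n. n \<ge> 1 \<Longrightarrow> l ^ n \<noteq> 1" and z: "cmod z = 1" and "\<epsilon> > 0"
  obtains k where "k > N" "cmod (l ^ k - z) < \<epsilon>"
proof -
  have l0: "l \<noteq> 0" using l by auto
  obtain t where t: "l = cis t"
    using complex_unimodular_polar[OF l] by (metis cis.code)
  define \<theta> where "\<theta> = t / (2 * pi)"
  have lk: "l ^ k = cis (2 * pi * frac (real k * \<theta>))" for k
  proof -
    have "l ^ k = cis (2 * pi * (real k * \<theta>))"
      unfolding t by (simp add: Complex.DeMoivre \<theta>_def mult_ac)
    also have "2 * pi * (real k * \<theta>) = 2 * pi * frac (real k * \<theta>) + 2 * pi * of_int \<lfloor>real k * \<theta>\<rfloor>"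
      by (simp add: frac_def algebra_simps)
    also have "cis \<dots> = cis (2 * pi * frac (real k * \<theta>))"
      unfolding cis_mult[symmetric] by (simp add: cis_multiple_2pi)
    finally show ?thesis .
  qed
  have "\<theta> \<notin> \<rat>"
  proof
    assume "\<theta> \<in> \<rat>"
    then obtain m n where mn: "n > 0" "\<theta> = of_int m / of_int n"
      by (rule Rats_cases')
    then have "real (nat n) * \<theta> = of_int m" by simp
    then have "l ^ nat n = 1" unfolding lk by simp
    then show False using nr[of "nat n"] mn by simp
  qed
  \<comment> \<open>Approximating \<open>z / l\<^sup>N\<close> by \<open>l\<^sup>k\<close> with \<open>k > 0\<close> forces the exponent \<open>N + k\<close> beyond \<open>N\<close>.\<close>
  define w where "w = z / l ^ N"
  have "cmod w = 1" using l z by (simp add: w_def norm_divide norm_power)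
  then obtain s where s: "w = cis s" "0 \<le> s" "s < 2 * pi"
    using complex_unimodular_polar by (metis cis.code)
  have "continuous (at (s / (2 * pi))) (\<lambda>u. cis (2 * pi * u))"
    using continuous_on_eq_continuous_at[OF open_UNIV, of "\<lambda>u. cis (2 * pi * u)"]
    by (auto intro!: continuous_intros)
  then obtain \<delta> where "\<delta> > 0" and \<delta>: "\<And>u. \<bar>u - s / (2 * pi)\<bar> < \<delta> \<Longrightarrow> cmod (cis (2 * pi * u) - w) < \<epsilon>"
    using \<open>\<epsilon> > 0\<close> unfolding continuous_at_eps_delta by (auto simp: dist_norm s(1))
  obtain k where k: "k > 0" "\<bar>frac (real k * \<theta>) - s / (2 * pi)\<bar> < \<delta>"
    using Kronecker_approx_1_explicit[OF \<open>\<theta> \<notin> \<rat>\<close>, of "s / (2 * pi)" \<delta>] s \<open>\<delta> > 0\<close> by auto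
  have "l ^ (N + k) - z = l ^ N * (l ^ k - w)"
    using l0 by (simp add: w_def power_add algebra_simps)
  then have "cmod (l ^ (N + k) - z) < \<epsilon>"
    using \<delta>[OF k(2)] l by (simp add: norm_mult norm_power lk)
  with k(1) show ?thesis by (intro that[of "N + k"]) auto
qed

lemma powers_subsequence_to_circle_point:
  fixes l z :: complex
  assumes l: "cmod l = 1" and nr: "\<And>n. n \<ge> 1 \<Longrightarrow> l ^ n \<noteq> 1" and z: "cmod z = 1"
  obtains r where "strict_mono r" "(\<lambda>n. l ^ Suc (r n)) \<longlonglongrightarrow> z"
proof -
  have "\<exists>r. \<forall>n. cmod (l ^ Suc (r n) - z) < 1 / real (Suc n) \<and> r n < r (Suc n)"
  proof (rule dependent_nat_choice)
    show "\<exists>k. cmod (l ^ Suc k - z) < 1 / real (Suc 0)"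
      using dense_powers_unit_circle[OF l nr z, of 1 0] by (metis Suc_pred' less_numeral_extra(1) div_by_1 of_nat_1 One_nat_def)
    fix k n :: nat
    obtain m where "m > Suc k" "cmod (l ^ m - z) < 1 / real (Suc (Suc n))"
      using dense_powers_unit_circle[OF l nr z, of "1 / real (Suc (Suc n))" "Suc k"] by auto
    then show "\<exists>m. cmod (l ^ Suc m - z) < 1 / real (Suc (Suc n)) \<and> k < m"
      by (metis Suc_lessE)
  qed
  then obtain r where r: "\<And>n. cmod (l ^ Suc (r n) - z) < 1 / real (Suc n)" "\<And>n. r n < r (Suc n)"
    by blast
  have "(\<lambda>n. l ^ Suc (r n) - z) \<longlonglongrightarrow> 0"
    by (rule tendsto_norm_zero_cancel, rule tendsto_sandwich[OF _ _ tendsto_const LIMSEQ_inverse_real_of_nat])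
       (use r(1) in \<open>auto simp: inverse_eq_divide intro!: always_eventually less_imp_le\<close>)
  then have "(\<lambda>n. l ^ Suc (r n)) \<longlonglongrightarrow> z" by (rule LIM_zero_cancel)
  moreover have "strict_mono r" using r(2) by (simp add: strict_mono_Suc_iff)
  ultimately show ?thesis by (rule that[rotated])
qed

section \<open>Limits in the Riemann sphere\<close>

text \<open>The quotient is continuous on pairs of homogeneous coordinates, also where the limit is infinity: a
  neighbourhood of infinity misses only points of modulus at most some \<open>B\<close>, and
  \<open>|u| > B |v|\<close> eventually when \<open>v\<close> tends to \<open>0\<close> and \<open>u\<close> does not.\<close>

lemma limitin_sphere_div:
  assumes u: "(u \<longlongrightarrow> u0) F" and v: "(v \<longlongrightarrow> v0) F" and nz: "u0 \<noteq> 0 \<or> v0 \<noteq> 0"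
  shows "limitin riemann_topology (\<lambda>n. sphere_div (u n) (v n)) (sphere_div u0 v0) F"
proof (cases "v0 = 0")
  case False
  have "limitin euclidean (\<lambda>n. u n / v n) (u0 / v0) F"
    using tendsto_divide[OF u v False] by simp
  then have "limitin riemann_topology (Some \<circ> (\<lambda>n. u n / v n)) (Some (u0 / v0)) F"
    by (rule continuous_map_limit[OF continuous_map_Some])
  moreover have "eventually (\<lambda>n. (Some \<circ> (\<lambda>n. u n / v n)) n = sphere_div (u n) (v n)) F"
    using tendsto_imp_eventually_ne[OF v False]
    by (rule eventually_mono) (auto simp: sphere_div_def)
  ultimately show ?thesis
    using False limitin_transform_eventually by (fastforce simp: sphere_div_def)
next
  case True
  with nz have u0: "u0 \<noteq> 0" by simp
  show ?thesis unfolding limitin_def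
  proof (intro conjI allI impI)
    fix U assume U: "openin riemann_topology U \<and> sphere_div u0 v0 \<in> U"
    then obtain K where K: "compact K" and UK: "U = insert None (Some ` (- K))"
      using True by (auto simp: openin_Alexandroff_compactification sphere_div_def Compl_eq_Diff_UNIV)
    obtain B where B: "\<And>w. w \<in> K \<Longrightarrow> cmod w \<le> B"
      using compact_imp_bounded[OF K] by (auto simp: bounded_iff)
    have "((\<lambda>n. cmod (u n) - B * cmod (v n)) \<longlongrightarrow> cmod u0 - B * cmod v0) F"
      by (intro tendsto_intros u v)
    then have "eventually (\<lambda>n. 0 < cmod (u n) - B * cmod (v n)) F"
      by (rule order_tendstoD) (use True u0 in simp)
    then show "eventually (\<lambda>n. sphere_div (u n) (v n) \<in> U) F"
    proof (rule eventually_mono)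
      fix n assume n: "0 < cmod (u n) - B * cmod (v n)"
      show "sphere_div (u n) (v n) \<in> U"
      proof (cases "v n = 0")
        case False
        then have "\<not> cmod (u n / v n) \<le> B" using n by (simp add: norm_divide pos_divide_le_eq)
        then show ?thesis using B[of "u n / v n"] False UK by (auto simp: sphere_div_def)
      qed (simp add: sphere_div_def UK)
    qed
  qed (simp add: sphere_div_def)
qed

lemma Hausdorff_riemann_topology: "Hausdorff_space riemann_topology"
  by (simp add: Hausdorff_space_Alexandroff_compactification locally_compact_space_euclidean)

text \<open>Along a subsequence on which \<open>l\<^sup>n\<^sup>+\<^sup>1\<close> tends to \<open>z\<close> the values tend to \<open>h(z)\<close>. Density of the powers
  makes every \<open>h(z)\<close> a limit; conversely every convergent subsequence can be refined to one of this kind,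
  because the circle is compact, and limits in the sphere are unique.\<close>

lemma seq_closure_asymptotic_moebius:
  fixes l :: complex
  assumes l: "cmod l = 1" and nr: "\<And>n. n \<ge> 1 \<Longrightarrow> l ^ n \<noteq> 1"
    and a: "a' \<longlonglongrightarrow> a" and b: "b' \<longlonglongrightarrow> b" and c: "c' \<longlonglongrightarrow> c" and d: "d' \<longlonglongrightarrow> d"
    and D: "a * d - b * c \<noteq> 0"
  shows "seq_closure riemann_topology
           (\<lambda>n. sphere_div (a' n * l ^ Suc n + b' n) (c' n * l ^ Suc n + d' n)) =
         sphere_moebius a b c d ` sphere 0 1"
    (is "seq_closure _ ?f = _")
proof -
  have nz: "a * z + b \<noteq> 0 \<or> c * z + d \<noteq> 0" for z
  proof (rule ccontr)
    assume "\<not> (a * z + b \<noteq> 0 \<or> c * z + d \<noteq> 0)"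
    then have "a * z + b = 0" "c * z + d = 0" by auto
    moreover have "a * d - b * c = a * (c * z + d) - c * (a * z + b)" by (simp add: algebra_simps)
    ultimately show False using D by simp
  qed
  have lim: "limitin riemann_topology (?f \<circ> r) (sphere_moebius a b c d z) sequentially"
    if r: "strict_mono r" and z: "(\<lambda>n. l ^ Suc (r n)) \<longlonglongrightarrow> z" for r z
    unfolding sphere_moebius_def comp_def
    using LIMSEQ_subseq_LIMSEQ[OF a r] LIMSEQ_subseq_LIMSEQ[OF b r]
      LIMSEQ_subseq_LIMSEQ[OF c r] LIMSEQ_subseq_LIMSEQ[OF d r] z
    by (intro limitin_sphere_div tendsto_add tendsto_mult nz) (simp_all only: comp_def)
  show ?thesis
  proof (intro set_eqI iffI)
    fix w assume "w \<in> seq_closure riemann_topology ?f"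
    then obtain r where r: "strict_mono r" and w: "limitin riemann_topology (?f \<circ> r) w sequentially"
      by (auto simp: seq_closure_def)
    have "seq_compact (sphere (0::complex) 1)"
      using compact_sphere compact_imp_seq_compact by blast
    moreover have "\<forall>n. l ^ Suc (r n) \<in> sphere 0 1"
      using l by (simp add: norm_power norm_mult)
    ultimately obtain z s where z: "z \<in> sphere 0 1" and s: "strict_mono s"
      and lim_z: "((\<lambda>n. l ^ Suc (r n)) \<circ> s) \<longlonglongrightarrow> z"
      by (rule seq_compactE)
    have "limitin riemann_topology (?f \<circ> (r \<circ> s)) (sphere_moebius a b c d z) sequentially"
      using lim[of "r \<circ> s" z] strict_mono_o[OF r s] lim_z by (simp add: comp_def)
    moreover have "limitin riemann_topology (?f \<circ> (r \<circ> s)) w sequentially"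
      using limitin_subsequence[OF s w] by (simp add: comp_assoc)
    ultimately have "w = sphere_moebius a b c d z"
      using limitin_Hausdorff_unique[OF _ _ trivial_limit_sequentially Hausdorff_riemann_topology]
      by blast
    with z show "w \<in> sphere_moebius a b c d ` sphere 0 1" by blast
  next
    fix w assume "w \<in> sphere_moebius a b c d ` sphere 0 1"
    then obtain z where z: "cmod z = 1" "w = sphere_moebius a b c d z" by auto
    obtain r where "strict_mono r" "(\<lambda>n. l ^ Suc (r n)) \<longlonglongrightarrow> z"
      using powers_subsequence_to_circle_point[OF l nr z(1)] by blast
    then show "w \<in> seq_closure riemann_topology ?f"
      using lim z(2) by (auto simp: seq_closure_def)
  qed
qed



section \<open>Concentration along a Moebius image of the unit circle\<close>

text \<open>This is \<open>1 / (2 \<pi> |h'(z)|)\<close>. The formula vanishes at the pole of \<open>h\<close>, so it also covers the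
  point at infinity.\<close>

lemma concentration_moebius:
  assumes D: "a * d - b * c \<noteq> 0" and z: "cmod z = 1"
  shows "concentration (sphere_moebius a b c d) (sphere_moebius a b c d z) =
           (cmod (c * z + d))\<^sup>2 / (2 * pi * cmod (a * d - b * c))"
proof (cases "c * z + d = 0")
  case True
  then show ?thesis by (simp add: sphere_moebius_def sphere_div_def concentration_def)
next
  case False
  define w where "w = (a * z + b) / (c * z + d)"
  have w: "sphere_moebius a b c d z = Some w"
    using False by (simp add: sphere_moebius_def sphere_div_def w_def)
  have "Some w \<in> sphere_moebius a b c d ` sphere 0 1"
    unfolding w[symmetric] using z by simp
  moreover have "a - c * w = (a * d - b * c) / (c * z + d)"
    using False by (simp add: w_def field_simps)
  ultimately show ?thesis
    using D False unfolding w concentration_Some[OF D \<open>Some w \<in> _\<close>]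
    by (simp add: norm_divide power_divide power2_eq_square)
qed

text \<open>Equality in the triangle inequality for \<open>c z + d\<close> holds only where \<open>c z\<close> is a positive multiple of \<open>d\<close>.\<close>

lemma norm_affine_maximal_iff:
  fixes c d z :: complex
  assumes cd: "c * d \<noteq> 0" and z: "cmod z = 1"
  shows "(\<forall>z'\<in>sphere 0 1. cmod (c * z' + d) \<le> cmod (c * z + d)) \<longleftrightarrow>
           z = (d / cmod d) / (c / cmod c)"
proof -
  define z0 where "z0 = (d / cmod d) / (c / cmod c)"
  have nz: "c \<noteq> 0" "d \<noteq> 0" using cd by auto
  have z0: "cmod z0 = 1" using nz by (simp add: z0_def norm_divide norm_mult)
  have eq_iff: "cmod (c * y + d) = cmod c + cmod d \<longleftrightarrow> y = z0" if "cmod y = 1" for y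
    using norm_triangle_eq[of "c * y" d] that nz
    by (simp add: norm_mult scaleR_conv_of_real z0_def field_simps) (auto simp: mult_ac)
  have le: "cmod (c * y + d) \<le> cmod c + cmod d" if "cmod y = 1" for y
    using norm_triangle_ineq[of "c * y" d] that by (simp add: norm_mult)
  have "(\<forall>z'\<in>sphere 0 1. cmod (c * z' + d) \<le> cmod (c * z + d)) \<longleftrightarrow> z = z0"
  proof
    assume "\<forall>z'\<in>sphere 0 1. cmod (c * z' + d) \<le> cmod (c * z + d)"
    then have "cmod (c * z0 + d) \<le> cmod (c * z + d)" using z0 by simp
    then show "z = z0" using eq_iff[OF z] eq_iff[OF z0] le[OF z] by simp
  next
    assume "z = z0"
    then show "\<forall>z'\<in>sphere 0 1. cmod (c * z' + d) \<le> cmod (c * z + d)"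
      using eq_iff[OF z] le by simp
  qed
  then show ?thesis by (simp add: z0_def)
qed

text \<open>The parallelogram law: minimising \<open>|c z + d|\<close> at \<open>z\<close> is the same as maximising it at \<open>-z\<close>.\<close>

lemma norm_affine_antipodal:
  fixes c d z :: complex
  assumes "cmod z = 1"
  shows "(cmod (c * z + d))\<^sup>2 + (cmod (c * (- z) + d))\<^sup>2 = 2 * ((cmod c)\<^sup>2 + (cmod d)\<^sup>2)"
proof -
  have "(cmod (d + c * z))\<^sup>2 + (cmod (d - c * z))\<^sup>2 = 2 * ((cmod (c * z))\<^sup>2 + (cmod d)\<^sup>2)"
    unfolding cmod_power2 by (simp add: power2_eq_square algebra_simps)
  then show ?thesis using assms by (simp add: norm_mult add.commute)
qed

lemma norm_affine_minimal_iff: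
  fixes c d z :: complex
  assumes cd: "c * d \<noteq> 0" and z: "cmod z = 1"
  shows "(\<forall>z'\<in>sphere 0 1. cmod (c * z + d) \<le> cmod (c * z' + d)) \<longleftrightarrow>
           z = - ((d / cmod d) / (c / cmod c))"
proof -
  have swap: "cmod (c * z + d) \<le> cmod (c * z' + d) \<longleftrightarrow>
      cmod (c * (- z') + d) \<le> cmod (c * (- z) + d)" if "cmod z' = 1" for z'
    using norm_affine_antipodal[OF z, of c d] norm_affine_antipodal[OF that, of c d]
    unfolding abs_le_square_iff[of "cmod _" "cmod _", unfolded abs_norm_cancel] by linarith
  have "(\<forall>z'\<in>sphere 0 1. cmod (c * z + d) \<le> cmod (c * z' + d)) \<longleftrightarrow>
      (\<forall>z'\<in>sphere 0 1. cmod (c * (- z') + d) \<le> cmod (c * (- z) + d))"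
    using swap by auto
  also have "\<dots> \<longleftrightarrow> (\<forall>z'\<in>uminus ` sphere 0 1. cmod (c * z' + d) \<le> cmod (c * (- z) + d))"
    by simp
  also have "uminus ` sphere 0 1 = (sphere 0 1 :: complex set)"
    by (force simp: image_iff intro: bexI[of _ "- _"])
  also have "(\<forall>z'\<in>sphere 0 1. cmod (c * z' + d) \<le> cmod (c * (- z) + d)) \<longleftrightarrow>
      - z = (d / cmod d) / (c / cmod c)"
    by (rule norm_affine_maximal_iff[OF cd]) (use z in simp)
  finally show ?thesis by (metis minus_minus)
qed

text \<open>For \<open>s = 1\<close> and \<open>s = -1\<close> these are the values at the two extremal points; the common
  factor \<open>d / |d|\<close> of numerator and denominator is cancelled.\<close>

lemma sphere_moebius_at_ratio:
  fixes c d :: complex and s :: real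
  assumes cd: "c * d \<noteq> 0" and s: "s\<^sup>2 = 1"
  shows "sphere_moebius a b c d (s * ((d / cmod d) / (c / cmod c))) =
           sphere_div (s * (a / c) * cmod c + b / d * cmod d) (s * cmod c + cmod d)"
proof -
  have nz: "c \<noteq> 0" "d \<noteq> 0" using cd by auto
  have "a * (s * ((d / cmod d) / (c / cmod c))) + b =
      (d / cmod d) * (s * (a / c) * cmod c + b / d * cmod d)"
    "c * (s * ((d / cmod d) / (c / cmod c))) + d = (d / cmod d) * (s * cmod c + cmod d)"
    using nz by (simp_all add: field_simps)
  then show ?thesis
    using nz by (simp only: sphere_moebius_def sphere_div_def) (simp del: of_real_add)
qed

lemma concentration_extremal_points:
  assumes D: "a * d - b * c \<noteq> 0" and cd: "c * d \<noteq> 0"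
  defines "T \<equiv> sphere_moebius a b c d ` sphere 0 1"
    and "\<kappa> \<equiv> concentration (sphere_moebius a b c d)"
  shows "{w \<in> T. \<forall>v\<in>T. \<kappa> v \<le> \<kappa> w} =
           {sphere_div (a / c * cmod c + b / d * cmod d) (cmod c + cmod d)}"
    and "{w \<in> T. \<forall>v\<in>T. \<kappa> w \<le> \<kappa> v} =
           {sphere_div (- (a / c) * cmod c + b / d * cmod d) (- cmod c + cmod d)}"
proof -
  define h where "h = sphere_moebius a b c d"
  define z0 where "z0 = (d / cmod d) / (c / cmod c)"
  have z0: "cmod z0 = 1" using cd by (auto simp: z0_def norm_divide norm_mult)
  have T: "T = h ` sphere 0 1" by (simp add: T_def h_def)
  have le_iff: "\<kappa> (h z) \<le> \<kappa> (h z') \<longleftrightarrow> cmod (c * z + d) \<le> cmod (c * z' + d)"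
    if "cmod z = 1" "cmod z' = 1" for z z'
    using D unfolding \<kappa>_def h_def concentration_moebius[OF D that(1)] concentration_moebius[OF D that(2)]
    by (simp add: divide_le_cancel mult_less_0_iff abs_le_square_iff[symmetric])
  have "{w \<in> T. \<forall>v\<in>T. \<kappa> v \<le> \<kappa> w} =
      h ` {z \<in> sphere 0 1. \<forall>z'\<in>sphere 0 1. cmod (c * z' + d) \<le> cmod (c * z + d)}"
    unfolding T using le_iff by auto
  also have "{z \<in> sphere 0 1. \<forall>z'\<in>sphere 0 1. cmod (c * z' + d) \<le> cmod (c * z + d)} =
      {z \<in> sphere 0 1. z = z0}"
    by (intro Collect_cong conj_cong refl norm_affine_maximal_iff[OF cd, folded z0_def]) simp
  also have "\<dots> = {z0}"
    using z0 by auto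
  finally show "{w \<in> T. \<forall>v\<in>T. \<kappa> v \<le> \<kappa> w} =
      {sphere_div (a / c * cmod c + b / d * cmod d) (cmod c + cmod d)}"
    using sphere_moebius_at_ratio[OF cd, of 1 a b] by (simp add: h_def z0_def)
  have "{w \<in> T. \<forall>v\<in>T. \<kappa> w \<le> \<kappa> v} =
      h ` {z \<in> sphere 0 1. \<forall>z'\<in>sphere 0 1. cmod (c * z + d) \<le> cmod (c * z' + d)}"
    unfolding T using le_iff by auto
  also have "{z \<in> sphere 0 1. \<forall>z'\<in>sphere 0 1. cmod (c * z + d) \<le> cmod (c * z' + d)} =
      {z \<in> sphere 0 1. z = - z0}"
    by (intro Collect_cong conj_cong refl norm_affine_minimal_iff[OF cd, folded z0_def]) simp
  also have "\<dots> = {- z0}"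
    using z0 by auto
  finally show "{w \<in> T. \<forall>v\<in>T. \<kappa> w \<le> \<kappa> v} =
      {sphere_div (- (a / c) * cmod c + b / d * cmod d) (- cmod c + cmod d)}"
    using sphere_moebius_at_ratio[OF cd, of "-1" a b] by (simp add: h_def z0_def)
qed

text \<open>If \<open>c = 0\<close> or \<open>d = 0\<close>, then \<open>|c z + d|\<close> is constant on the unit circle.\<close>

lemma concentration_constant:
  assumes D: "a * d - b * c \<noteq> 0" and cd: "c = 0 \<or> d = 0"
    and v: "v \<in> sphere_moebius a b c d ` sphere 0 1" and w: "w \<in> sphere_moebius a b c d ` sphere 0 1"
  shows "concentration (sphere_moebius a b c d) v = concentration (sphere_moebius a b c d) w"
  using v w cd concentration_moebius[OF D] by (auto simp: norm_mult)

section \<open>Moebius images of the unit circle as circles and lines\<close>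

text \<open>The inverse transformation is \<open>w \<mapsto> (d w - b) / (a - c w)\<close>, so the condition says that the preimage has
  modulus \<open>1\<close>. The two sides cannot both vanish, since
  \<open>a d - b c = d (a - c w) + c (d w - b)\<close>.\<close>

lemma Some_in_moebius_circle_iff:
  assumes D: "a * d - b * c \<noteq> 0"
  shows "Some w \<in> sphere_moebius a b c d ` sphere 0 1 \<longleftrightarrow> cmod (d * w - b) = cmod (a - c * w)"
proof
  assume "Some w \<in> sphere_moebius a b c d ` sphere 0 1"
  then obtain z where z: "cmod z = 1" "c * z + d \<noteq> 0" "w = (a * z + b) / (c * z + d)"
    by (auto simp: sphere_moebius_def sphere_div_def split: if_splits)
  have "d * w - b = z * (a - c * w)"
    using z(2) unfolding z(3) by (simp add: field_simps)
  then show "cmod (d * w - b) = cmod (a - c * w)" using z(1) by (simp add: norm_mult)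
next
  assume eq: "cmod (d * w - b) = cmod (a - c * w)"
  have D_eq: "a * d - b * c = d * (a - c * w) + c * (d * w - b)" by (simp add: algebra_simps)
  have nz: "a - c * w \<noteq> 0"
  proof
    assume "a - c * w = 0"
    then show False using eq D unfolding D_eq by simp
  qed
  define z where "z = (d * w - b) / (a - c * w)"
  have "cmod z = 1" using eq nz by (simp add: z_def norm_divide)
  moreover have "c * z + d = (a * d - b * c) / (a - c * w)"
      "a * z + b = w * ((a * d - b * c) / (a - c * w))"
    using nz unfolding z_def by (simp_all add: field_simps)
  then have "sphere_moebius a b c d z = Some w"
    using D nz by (simp add: sphere_moebius_def sphere_div_def)
  ultimately show "Some w \<in> sphere_moebius a b c d ` sphere 0 1"
    by (metis imageI mem_sphere_0)
qed

lemma None_in_moebius_circle_iff: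
  assumes D: "a * d - b * c \<noteq> 0"
  shows "None \<in> sphere_moebius a b c d ` sphere 0 1 \<longleftrightarrow> cmod c = cmod d"
proof
  assume "None \<in> sphere_moebius a b c d ` sphere 0 1"
  then obtain z where z: "cmod z = 1" "c * z + d = 0"
    by (auto simp: sphere_moebius_def sphere_div_def split: if_splits)
  then have "d = - (c * z)" by (simp add: eq_neg_iff_add_eq_0 add.commute)
  then show "cmod c = cmod d" using z(1) by (simp add: norm_mult)
next
  assume eq: "cmod c = cmod d"
  then have c: "c \<noteq> 0" using D by auto
  then have "d \<noteq> 0" using eq by auto
  with c have "cmod (- d / c) = 1" "sphere_moebius a b c d (- d / c) = None"
    using eq by (simp_all add: norm_divide sphere_moebius_def sphere_div_def)
  then show "None \<in> sphere_moebius a b c d ` sphere 0 1"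
    by (metis imageI mem_sphere_0)
qed

text \<open>Completing the square in the equation of the Apollonius locus.\<close>

lemma apollonius_identity:
  fixes a b c d w :: complex
  defines "k \<equiv> (cmod c)\<^sup>2 - (cmod d)\<^sup>2"
  shows "(cmod (k * w - (a * cnj c - b * cnj d)))\<^sup>2 - (cmod (a * d - b * c))\<^sup>2 =
           k * ((cmod (a - c * w))\<^sup>2 - (cmod (d * w - b))\<^sup>2)"
proof -
  have k: "complex_of_real k = c * cnj c - d * cnj d"
    by (simp add: k_def complex_norm_square del: of_real_power)
  have "complex_of_real ((cmod (k * w - (a * cnj c - b * cnj d)))\<^sup>2 - (cmod (a * d - b * c))\<^sup>2) =
      complex_of_real (k * ((cmod (a - c * w))\<^sup>2 - (cmod (d * w - b))\<^sup>2))"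
    unfolding of_real_diff of_real_mult complex_norm_square k by (simp add: algebra_simps)
  then show ?thesis by (simp only: of_real_eq_iff)
qed

lemma moebius_circle_eq_sphere:
  fixes a b c d :: complex
  assumes D: "a * d - b * c \<noteq> 0" and ne: "cmod c \<noteq> cmod d"
  defines "k \<equiv> (cmod c)\<^sup>2 - (cmod d)\<^sup>2"
  shows "sphere_moebius a b c d ` sphere 0 1 =
           Some ` sphere ((a * cnj c - b * cnj d) / k) (cmod ((a * d - b * c) / k))"
proof -
  have k: "k \<noteq> 0" using ne by (simp add: k_def power2_eq_iff_nonneg)
  have "Some w \<in> sphere_moebius a b c d ` sphere 0 1 \<longleftrightarrow>
      w \<in> sphere ((a * cnj c - b * cnj d) / k) (cmod ((a * d - b * c) / k))" for w
  proof -
    have "Some w \<in> sphere_moebius a b c d ` sphere 0 1 \<longleftrightarrow>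
        (cmod (a - c * w))\<^sup>2 - (cmod (d * w - b))\<^sup>2 = 0"
      unfolding Some_in_moebius_circle_iff[OF D] by (auto simp: power2_eq_iff_nonneg)
    also have "\<dots> \<longleftrightarrow> (cmod (k * w - (a * cnj c - b * cnj d)))\<^sup>2 - (cmod (a * d - b * c))\<^sup>2 = 0"
      using apollonius_identity[of c d w a b, folded k_def] k by simp
    also have "\<dots> \<longleftrightarrow> cmod (k * w - (a * cnj c - b * cnj d)) = cmod (a * d - b * c)"
      by (simp add: power2_eq_iff_nonneg)
    also have "\<dots> \<longleftrightarrow> cmod (w - (a * cnj c - b * cnj d) / k) = cmod ((a * d - b * c) / k)"
    proof -
      have "k * w - (a * cnj c - b * cnj d) = k * (w - (a * cnj c - b * cnj d) / k)"
        using k by (simp add: field_simps)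
      then show ?thesis using k by (simp add: norm_mult norm_divide eq_divide_eq mult.commute)
    qed
    finally show ?thesis by (simp add: dist_norm norm_minus_commute)
  qed
  moreover have "None \<notin> sphere_moebius a b c d ` sphere 0 1"
    using None_in_moebius_circle_iff[OF D] ne by simp
  ultimately show ?thesis
    by (intro set_eqI, rename_tac x, case_tac x) auto
qed

text \<open>The numerator is \<open>m\<close> times the denominator, because \<open>|t|\<^sup>2 = m t\<^sup>* + m\<^sup>* t + r\<^sup>2 - |m|\<^sup>2\<close> for the points \<open>t\<close> of the
  circle and the contributions of the last three terms cancel cyclically. For the denominator to be non-zero
  the points must not be collinear: with \<open>u, v, w\<close> the radius vectors, it equals
  \<open>- r\<^sup>2 (u - v) (v - w) (w - u) / (u v w)\<close>.\<close>

lemma circumcenter_formula: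
  fixes x y z m :: complex and r :: real
  assumes on: "x \<in> sphere m r" "y \<in> sphere m r" "z \<in> sphere m r"
    and ne: "x \<noteq> y" "y \<noteq> z" "z \<noteq> x"
  shows "m = ((cmod x)\<^sup>2 * (y - z) + (cmod y)\<^sup>2 * (z - x) + (cmod z)\<^sup>2 * (x - y)) /
             (x * (cnj z - cnj y) + y * (cnj x - cnj z) + z * (cnj y - cnj x))"
    (is "m = ?N / ?E")
proof -
  define u v w where "u = x - m" "v = y - m" "w = z - m"
  have xyz: "x = m + u" "y = m + v" "z = m + w" by (auto simp: u_v_w_def)
  have sq: "u * cnj u = (of_real r)\<^sup>2" "v * cnj v = (of_real r)\<^sup>2" "w * cnj w = (of_real r)\<^sup>2"
    using on unfolding u_v_w_def complex_norm_square[symmetric]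
    by (simp_all add: dist_norm norm_minus_commute flip: of_real_power)
  have r: "r \<noteq> 0" using on ne by auto
  have E: "?E = u * (cnj w - cnj v) + v * (cnj u - cnj w) + w * (cnj v - cnj u)"
    unfolding xyz by (simp add: algebra_simps)
  have "u * v * w * ?E = - ((of_real r)\<^sup>2 * (u - v) * (v - w) * (w - u))"
  proof -
    have "u * v * w * ?E = v * w * (v - w) * (u * cnj u) + u * w * (w - u) * (v * cnj v) + u * v * (u - v) * (w * cnj w)"
      unfolding E by (simp add: algebra_simps)
    also have "\<dots> = - ((of_real r)\<^sup>2 * (u - v) * (v - w) * (w - u))"
      unfolding sq by (simp add: algebra_simps)
    finally show ?thesis .
  qed
  then have "?E \<noteq> 0" using r ne by (auto simp: u_v_w_def)
  moreover have "?N = m * ?E"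
  proof -
    have n: "complex_of_real ((cmod (m + t))\<^sup>2) = m * cnj m + m * cnj t + t * cnj m + t * cnj t" for t
      unfolding complex_norm_square by (simp add: algebra_simps)
    show ?thesis
      unfolding E unfolding xyz of_real_power[symmetric] n sq by (simp add: algebra_simps)
  qed
  ultimately show ?thesis by simp
qed

text \<open>In the coordinate \<open>v\<close> centred at the midpoint of \<open>x\<close> and \<open>y\<close>, with \<open>y - x\<close> as unit, the points
  are those with \<open>|v + 1/2| = |v - 1/2|\<close>, that is, \<open>v\<close> purely imaginary.\<close>

lemma equidistant_eq_affine_hull:
  fixes x y :: complex
  assumes "x \<noteq> y"
  shows "{w. cmod (w - x) = cmod (w - y)} =
           affine hull {(x + y) / 2, (x + y) / 2 + \<i> * (y - x)}"
proof -
  have hull: "affine hull {(x + y) / 2, (x + y) / 2 + \<i> * (y - x)} =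
      range (\<lambda>t::real. (x + y) / 2 + t * (\<i> * (y - x)))" (is "?A = ?B")
  proof -
    have "?A = {s *\<^sub>R ((x + y) / 2) + t *\<^sub>R ((x + y) / 2 + \<i> * (y - x)) | s t. s + t = 1}"
      by (rule affine_hull_2)
    also have "\<dots> = ?B"
    proof (intro set_eqI iffI)
      fix w assume "w \<in> {s *\<^sub>R ((x + y) / 2) + t *\<^sub>R ((x + y) / 2 + \<i> * (y - x)) | s t. s + t = 1}"
      then obtain s t where w: "w = s *\<^sub>R ((x + y) / 2) + t *\<^sub>R ((x + y) / 2 + \<i> * (y - x))" "s + t = 1"
        by blast
      then have s: "s = 1 - t" by simp
      have "w = (x + y) / 2 + t * (\<i> * (y - x))"
        unfolding w(1) s scaleR_left_diff_distrib scaleR_right_distrib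
        by (simp add: scaleR_conv_of_real)
      then show "w \<in> ?B" by blast
    next
      fix w assume "w \<in> ?B"
      then obtain t :: real where w: "w = (x + y) / 2 + t * (\<i> * (y - x))" by blast
      have "w = (1 - t) *\<^sub>R ((x + y) / 2) + t *\<^sub>R ((x + y) / 2 + \<i> * (y - x))"
        unfolding w scaleR_left_diff_distrib scaleR_right_distrib
          by (simp add: scaleR_conv_of_real)
      then show "w \<in> {s *\<^sub>R ((x + y) / 2) + t *\<^sub>R ((x + y) / 2 + \<i> * (y - x)) | s t. s + t = 1}"
        by force
    qed
    finally show ?thesis .
  qed
  have "cmod (w - x) = cmod (w - y) \<longleftrightarrow> w \<in> ?B" for w
  proof -
    define v where "v = (w - (x + y) / 2) / (y - x)"
    have yx: "y - x \<noteq> 0" using assms by simp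
    have w: "w = (x + y) / 2 + v * (y - x)" using yx by (simp add: v_def)
    have e: "w - x = (y - x) * (v + 1 / 2)" "w - y = (y - x) * (v - 1 / 2)"
      unfolding w by (simp_all add: field_simps)
    have "cmod (w - x) = cmod (w - y) \<longleftrightarrow> cmod (v + 1 / 2) = cmod (v - 1 / 2)"
      unfolding e norm_mult using yx by simp
    also have "\<dots> \<longleftrightarrow> Re v = 0"
      by (simp add: cmod_def power2_eq_square algebra_simps)
    also have "\<dots> \<longleftrightarrow> w \<in> ?B"
    proof
      assume "Re v = 0"
      then have "v = Im v * \<i>" by (simp add: complex_eq_iff)
      then have "w = (x + y) / 2 + Im v * (\<i> * (y - x))" using w by (metis mult.assoc)
      then show "w \<in> ?B" by blast
    next
      assume "w \<in> ?B"
      then obtain t :: real where "w = (x + y) / 2 + t * (\<i> * (y - x))" by blast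
      then have "v = t * \<i>" using yx by (simp add: v_def)
      then show "Re v = 0" by simp
    qed
    finally show ?thesis .
  qed
  then show ?thesis unfolding hull by auto
qed

text \<open>The image passes through infinity exactly when \<open>|c| = |d|\<close>. In that case dividing the
  Apollonius equation by this common modulus leaves the perpendicular bisector of \<open>b / d\<close> and \<open>a / c\<close>.\<close>

lemma is_line_moebius_circle_iff:
  assumes D: "a * d - b * c \<noteq> 0"
  shows "is_line (sphere_moebius a b c d ` sphere 0 1) \<longleftrightarrow> cmod c = cmod d"
proof
  assume "is_line (sphere_moebius a b c d ` sphere 0 1)"
  then show "cmod c = cmod d"
    using None_in_moebius_circle_iff[OF D] by (auto simp: is_line_def)
next
  assume eq: "cmod c = cmod d"
  then have nz: "c \<noteq> 0" "d \<noteq> 0" using D by auto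
  define x y where "x = b / d" "y = a / c"
  have xy: "x \<noteq> y" using D nz by (auto simp: x_y_def field_simps)
  have "Some w \<in> sphere_moebius a b c d ` sphere 0 1 \<longleftrightarrow> cmod (w - x) = cmod (w - y)" for w
  proof -
    have "d * w - b = d * (w - x)" "a - c * w = c * (y - w)"
      using nz by (simp_all add: x_y_def field_simps)
    then show ?thesis
      unfolding Some_in_moebius_circle_iff[OF D] using nz eq by (simp add: norm_mult norm_minus_commute)
  qed
  then have "sphere_moebius a b c d ` sphere 0 1 = insert None (Some ` {w. cmod (w - x) = cmod (w - y)})"
    using None_in_moebius_circle_iff[OF D] eq
    by (intro set_eqI, rename_tac v, case_tac v) auto
  then show "is_line (sphere_moebius a b c d ` sphere 0 1)"
    unfolding is_line_def equidistant_eq_affine_hull[OF xy] using xy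
    by (intro exI[of _ "(x + y) / 2"] exI[of _ "(x + y) / 2 + \<i> * (y - x)"]) auto
qed

section \<open>The sequential closure of the approximants\<close>

theorem theorem8:
  fixes p q P Q :: "nat \<Rightarrow> complex"
    and \<alpha> \<beta> a b c d :: complex
    and h :: "complex \<Rightarrow> riemann_sphere"
    and approximants :: "nat \<Rightarrow> riemann_sphere"
    and T' :: "riemann_sphere set"
    and hc :: "complex \<Rightarrow> complex"
  assumes "summable (\<lambda>n. cmod (p (Suc n)) + cmod (q (Suc n)))"
    and "\<alpha> \<noteq> \<beta>" and "cmod \<alpha> = cmod \<beta>" and "cmod \<beta> \<noteq> 0"
    and "\<forall>n\<ge>1. q n \<noteq> \<alpha> * \<beta>"
    and "\<forall>n\<ge>1. (\<alpha> / \<beta>) ^ n \<noteq> 1"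
    and "P = cf_num (\<lambda>n. - \<alpha> * \<beta> + q n) (\<lambda>n. \<alpha> + \<beta> + p n)"
    and "Q = cf_den (\<lambda>n. - \<alpha> * \<beta> + q n) (\<lambda>n. \<alpha> + \<beta> + p n)"
    and "a = lim (\<lambda>n. (P (Suc n) - \<beta> * P n) / \<alpha> ^ Suc n)"
    and "b = - lim (\<lambda>n. (P (Suc n) - \<alpha> * P n) / \<beta> ^ Suc n)"
    and "c = lim (\<lambda>n. (Q (Suc n) - \<beta> * Q n) / \<alpha> ^ Suc n)"
    and "d = - lim (\<lambda>n. (Q (Suc n) - \<alpha> * Q n) / \<beta> ^ Suc n)"
    and "approximants = (\<lambda>n. sphere_div (P n) (Q n))"
    and "h = sphere_moebius a b c d"
    and "hc = moebius a b c d"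
    and "T' = h ` sphere 0 1"
  shows
    (* existence of the limits, nondegeneracy of h, and the sequential closure *)
    "convergent (\<lambda>n. (P (Suc n) - \<beta> * P n) / \<alpha> ^ Suc n) \<and>
     convergent (\<lambda>n. (P (Suc n) - \<alpha> * P n) / \<beta> ^ Suc n) \<and>
     convergent (\<lambda>n. (Q (Suc n) - \<beta> * Q n) / \<alpha> ^ Suc n) \<and>
     convergent (\<lambda>n. (Q (Suc n) - \<alpha> * Q n) / \<beta> ^ Suc n) \<and>
     a * d - b * c \<noteq> 0 \<and>
     seq_closure riemann_topology approximants = T' \<and>
     (c * d \<noteq> 0 \<longrightarrow>
        {w \<in> T'. \<forall>v\<in>T'. concentration h v \<le> concentration h w} =
          {sphere_div (a / c * cmod c + b / d * cmod d) (cmod c + cmod d)} \<and>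
        {w \<in> T'. \<forall>v\<in>T'. concentration h w \<le> concentration h v} =
          {sphere_div (- (a / c) * cmod c + b / d * cmod d) (- cmod c + cmod d)}) \<and>
     (c = 0 \<or> d = 0 \<longrightarrow>
        (\<forall>v\<in>T'. \<forall>w\<in>T'. concentration h v = concentration h w)) \<and>
     (cmod c \<noteq> cmod d \<longrightarrow>
        (let r = cmod ((\<alpha> - \<beta>) / ((cmod c)\<^sup>2 - (cmod d)\<^sup>2) * (\<Prod>n. 1 - q (Suc n) / (\<alpha> * \<beta>)));
             m = ((cmod (hc 1))\<^sup>2 * (hc (-1) - hc \<i>) + (cmod (hc (-1)))\<^sup>2 * (hc \<i> - hc 1)
                   + (cmod (hc \<i>))\<^sup>2 * (hc 1 - hc (-1)))
                 / (hc 1 * (cnj (hc \<i>) - cnj (hc (-1))) + hc (-1) * (cnj (hc 1) - cnj (hc \<i>))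
                   + hc \<i> * (cnj (hc (-1)) - cnj (hc 1)))
         in 0 < r \<and> T' = Some ` sphere m r)) \<and>
     (is_line T' \<longleftrightarrow> cmod c = cmod d) \<and>
     (cmod c = cmod d \<longrightarrow>
        {w \<in> T'. \<forall>v\<in>T'. concentration h w \<le> concentration h v} = {None})"
proof -
  define A where "A = (\<lambda>n. - \<alpha> * \<beta> + q n)"
  define B where "B = (\<lambda>n. \<alpha> + \<beta> + p n)"
  have P: "P = cf_num A B" and Q: "Q = cf_den A B"
    using assms(7,8) by (simp_all add: A_def B_def)
  have \<beta>: "\<beta> \<noteq> 0" and \<alpha>: "\<alpha> \<noteq> 0" using assms(3,4) by auto
  have sum2: "summable (\<lambda>n. cmod (p (Suc (Suc n))) + cmod (q (Suc (Suc n))))"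
    using assms(1) by (subst (asm) summable_Suc_iff[symmetric])
  have recP: "P (Suc (Suc n)) = (\<alpha> + \<beta> + p (Suc (Suc n))) * P (Suc n) + (- \<alpha> * \<beta> + q (Suc (Suc n))) * P n" for n
    by (simp add: P cf_num_def A_def B_def)
  have recQ: "Q (Suc (Suc n)) = (\<alpha> + \<beta> + p (Suc (Suc n))) * Q (Suc n) + (- \<alpha> * \<beta> + q (Suc (Suc n))) * Q n" for n
    by (simp add: Q cf_den_def A_def B_def)
  note convP = perturbed_recurrence_convergent[OF sum2 assms(2,3) \<beta>, of P, OF recP]
  note convQ = perturbed_recurrence_convergent[OF sum2 assms(2,3) \<beta>, of Q, OF recQ]
  \<comment> \<open>The minus signs in front of \<open>yP\<close> and \<open>yQ\<close> come from solving for the sequence: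
    \<open>(\<alpha> - \<beta>) P\<^sub>n = \<alpha>\<^sup>n\<^sup>+\<^sup>1 xP\<^sub>n - \<beta>\<^sup>n\<^sup>+\<^sup>1 yP\<^sub>n\<close>, and likewise for \<open>Q\<close>.\<close>
  define xP where "xP = (\<lambda>n. (P (Suc n) - \<beta> * P n) / \<alpha> ^ Suc n)"
  define yP where "yP = (\<lambda>n. (P (Suc n) - \<alpha> * P n) / \<beta> ^ Suc n)"
  define xQ where "xQ = (\<lambda>n. (Q (Suc n) - \<beta> * Q n) / \<alpha> ^ Suc n)"
  define yQ where "yQ = (\<lambda>n. (Q (Suc n) - \<alpha> * Q n) / \<beta> ^ Suc n)"
  have a: "xP \<longlonglongrightarrow> a" and c: "xQ \<longlonglongrightarrow> c"
    using convP(1) convQ(1) assms(9,11) by (simp_all add: xP_def xQ_def convergent_LIMSEQ_iff)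
  have b: "(\<lambda>n. - yP n) \<longlonglongrightarrow> b" and d: "(\<lambda>n. - yQ n) \<longlonglongrightarrow> d"
    using convP(2) convQ(2) assms(10,12)
    by (auto simp: yP_def yQ_def convergent_LIMSEQ_iff intro!: tendsto_minus)
  define K where "K = (\<Prod>n. 1 - q (Suc n) / (\<alpha> * \<beta>))"

  have prod: "convergent_prod (\<lambda>n. 1 - q (Suc n) / (\<alpha> * \<beta>))"
  proof (rule abs_convergent_prod_imp_convergent_prod, rule summable_imp_abs_convergent_prod)
    have "summable (\<lambda>n. cmod (q (Suc n)))"
      by (rule summable_comparison_test'[OF assms(1)]) simp
    then show "summable (\<lambda>n. cmod (1 - q (Suc n) / (\<alpha> * \<beta>) - 1))"
      by (simp add: norm_divide)
  qed
  have K0: "K \<noteq> 0"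
    unfolding K_def using prod by (rule prodinf_nonzero) (use assms(5) \<alpha> \<beta> in auto)
  have det: "xP n * (- yQ n) - (- yP n) * xQ n = (\<beta> - \<alpha>) * (\<Prod>k\<le>n. 1 - q (Suc k) / (\<alpha> * \<beta>))" for n
  proof -
    have "(\<Prod>k\<le>n. - A (Suc k)) = (\<Prod>k\<le>n. (\<alpha> * \<beta>) * (1 - q (Suc k) / (\<alpha> * \<beta>)))"
      using \<alpha> \<beta> by (intro prod.cong) (auto simp: A_def field_simps)
    also have "\<dots> = (\<alpha> * \<beta>) ^ Suc n * (\<Prod>k\<le>n. 1 - q (Suc k) / (\<alpha> * \<beta>))"
      by (simp add: prod.distrib)
    finally have cas: "P (Suc n) * Q n - P n * Q (Suc n) =
        - ((\<alpha> * \<beta>) ^ Suc n * (\<Prod>k\<le>n. 1 - q (Suc k) / (\<alpha> * \<beta>)))"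
      unfolding P Q cf_casorati by simp
    have "xP n * (- yQ n) - (- yP n) * xQ n =
        (\<alpha> - \<beta>) * (P (Suc n) * Q n - P n * Q (Suc n)) / (\<alpha> * \<beta>) ^ Suc n"
      using \<alpha> \<beta> by (simp add: xP_def yP_def xQ_def yQ_def power_mult_distrib divide_simps)
        (simp add: algebra_simps)
    also have "\<dots> = (\<beta> - \<alpha>) * (\<Prod>k\<le>n. 1 - q (Suc k) / (\<alpha> * \<beta>))"
      unfolding cas using \<alpha> \<beta> by (simp del: power_Suc) (simp add: algebra_simps)
    finally show ?thesis .
  qed
  have "(\<lambda>n. xP n * (- yQ n) - (- yP n) * xQ n) \<longlonglongrightarrow> a * d - b * c"
    by (intro tendsto_intros a b c d)
  moreover have "(\<lambda>n. xP n * (- yQ n) - (- yP n) * xQ n) \<longlonglongrightarrow> (\<beta> - \<alpha>) * K"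
    unfolding det K_def by (intro tendsto_intros convergent_prod_LIMSEQ prod)
  ultimately have D_eq: "a * d - b * c = (\<beta> - \<alpha>) * K" by (rule LIMSEQ_unique)
  then have D: "a * d - b * c \<noteq> 0" using K0 assms(2) by simp

  define l where "l = \<alpha> / \<beta>"
  have l: "cmod l = 1" "\<And>n. n \<ge> 1 \<Longrightarrow> l ^ n \<noteq> 1"
    using assms(3,4,6) by (auto simp: l_def norm_divide)
  \<comment> \<open>The common factor in front is the same for \<open>P\<close> and \<open>Q\<close> and cancels in the quotient.\<close>
  have solve: "R n = \<beta> ^ Suc n / (\<alpha> - \<beta>) * ((R (Suc n) - \<beta> * R n) / \<alpha> ^ Suc n * l ^ Suc n +
      - ((R (Suc n) - \<alpha> * R n) / \<beta> ^ Suc n))" for R :: "nat \<Rightarrow> complex" and n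
    using \<alpha> \<beta> assms(2) by (simp add: l_def power_divide divide_simps) (simp add: algebra_simps)
  have div: "approximants n = sphere_div (xP n * l ^ Suc n + - yP n) (xQ n * l ^ Suc n + - yQ n)" for n
  proof -
    have "\<beta> ^ Suc n / (\<alpha> - \<beta>) \<noteq> 0" using \<beta> assms(2) by simp
    then have cancel: "sphere_div (\<beta> ^ Suc n / (\<alpha> - \<beta>) * u) (\<beta> ^ Suc n / (\<alpha> - \<beta>) * v) =
        sphere_div u v" for u v
      by (simp only: sphere_div_def mult_eq_0_iff mult_divide_mult_cancel_left) simp
    have "approximants n = sphere_div (P n) (Q n)" by (simp add: assms(13))
    then show ?thesis
      unfolding xP_def yP_def xQ_def yQ_def
      using cancel solve[of P n] solve[of Q n] by metis
  qed
  have closure: "seq_closure riemann_topology approximants = T'"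
    unfolding assms(14,16) ext[of approximants, OF div]
    by (rule seq_closure_asymptotic_moebius[OF l a b c d D])
  have circle: "let r = cmod ((\<alpha> - \<beta>) / ((cmod c)\<^sup>2 - (cmod d)\<^sup>2) * (\<Prod>n. 1 - q (Suc n) / (\<alpha> * \<beta>)));
             m = ((cmod (hc 1))\<^sup>2 * (hc (-1) - hc \<i>) + (cmod (hc (-1)))\<^sup>2 * (hc \<i> - hc 1)
                   + (cmod (hc \<i>))\<^sup>2 * (hc 1 - hc (-1)))
                 / (hc 1 * (cnj (hc \<i>) - cnj (hc (-1))) + hc (-1) * (cnj (hc 1) - cnj (hc \<i>))
                   + hc \<i> * (cnj (hc (-1)) - cnj (hc 1)))
         in 0 < r \<and> T' = Some ` sphere m r" if ne: "cmod c \<noteq> cmod d"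
  proof -
    define k where "k = (cmod c)\<^sup>2 - (cmod d)\<^sup>2"
    define r where "r = cmod ((\<alpha> - \<beta>) / k * K)"
    define m where "m = (a * cnj c - b * cnj d) / k"
    have k: "k \<noteq> 0" using ne by (simp add: k_def power2_eq_iff_nonneg)
    have r: "r = cmod ((a * d - b * c) / k)"
      by (simp add: r_def D_eq norm_mult norm_divide norm_minus_commute)
    have T': "T' = Some ` sphere m r"
      unfolding assms(14,16) r m_def k_def by (rule moebius_circle_eq_sphere[OF D ne])
    \<comment> \<open>As \<open>|c| \<noteq> |d|\<close>, the transformation has no pole on the unit circle.\<close>
    have hc: "h z = Some (hc z)" if "cmod z = 1" for z
    proof -
      have "h z \<noteq> None"
        using that None_in_moebius_circle_iff[OF D] ne unfolding assms(14)
        by (metis imageI mem_sphere_0)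
      then show ?thesis
        by (auto simp: assms(14,15) sphere_moebius_def sphere_div_def moebius_def split: if_splits)
    qed
    have on: "hc z \<in> sphere m r" if "cmod z = 1" for z
      using hc[OF that] that T' unfolding assms(16) by (metis imageI imageE mem_sphere_0 option.inject)
    have inj: "hc z \<noteq> hc z'" if "cmod z = 1" "cmod z' = 1" "z \<noteq> z'" for z z'
      using hc[OF that(1)] hc[OF that(2)] that(3) sphere_moebius_inj[OF D] unfolding assms(14)
      by (metis injD)
    have "m = ((cmod (hc 1))\<^sup>2 * (hc (-1) - hc \<i>) + (cmod (hc (-1)))\<^sup>2 * (hc \<i> - hc 1)
                   + (cmod (hc \<i>))\<^sup>2 * (hc 1 - hc (-1)))
                 / (hc 1 * (cnj (hc \<i>) - cnj (hc (-1))) + hc (-1) * (cnj (hc 1) - cnj (hc \<i>))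
                   + hc \<i> * (cnj (hc (-1)) - cnj (hc 1)))"
      by (rule circumcenter_formula[of _ m r]) (use on inj in \<open>simp_all add: complex_eq_iff del: mem_sphere\<close>)
    moreover have "0 < r" using D k unfolding r by simp
    ultimately show ?thesis
      using T' unfolding Let_def r_def k_def K_def by simp
  qed
  have least: "{w \<in> T'. \<forall>v\<in>T'. concentration h w \<le> concentration h v} = {None}"
    if eq: "cmod c = cmod d"
  proof -
    \<comment> \<open>The minimum formula applies; its denominator \<open>- |c| + |d|\<close> is \<open>0\<close>.\<close>
    have "c * d \<noteq> 0" using eq D by auto
    then show ?thesis
      using concentration_extremal_points(2)[OF D] eq unfolding assms(14,16)
      by (simp add: sphere_div_def)
  qed
  note extremal = concentration_extremal_points[OF D, folded assms(14), folded assms(16)]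
  note const = concentration_constant[OF D, folded assms(14), folded assms(16)]
  note line = is_line_moebius_circle_iff[OF D, folded assms(14), folded assms(16)]
  show ?thesis
    by (intro conjI impI ballI)
      (fact convP convQ D closure line | (rule extremal circle least const; assumption))+
qed

end
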